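(* Let $X$ be a random walk on $\mathbb{R}$ with $X_0=0$, let $q\in(0,1)$, and let $f:U_+\to\mathbb{R}$ be a measurable and uniformly bounded function, where $U_+=\{(x_1,x_2)\in\mathbb{R}^2 : x_2\ge 0,\ x_1\le x_2\}$, such that the function $y\mapsto ((\mathcal{E}^-_q\otimes I)f_+)(y,y)$ from $\mathbb{R}$ to $\mathbb{R}$ is measurable. Then: (i) for any $x_1\le x_2$, $$(1-q)\tilde V(f;q;x_1,x_2)=((\mathcal{E}_q\otimes I)f_+)(x_1,x_2)+(\mathcal{E}^+_q\, w(f;q,\cdot,x_2))(x_1),$$ where $$w(f;q,y,x_2)=\mathbf{1}_{[x_2,+\infty)}(y)\Big(((\mathcal{E}^-_q\otimes I)f_+)(y,y)-((\mathcal{E}^-_q\otimes I)f_+)(y,x_2)\Big);$$ (ii) as a function of $q$, $\tilde V(f;q;x_1,x_2)$ admits analytic continuation to the open unit disc.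
   Context: Let $Y,Y_1,Y_2,\dots$ be i.i.d. real-valued random variables on a probability space $(\Omega,\mathcal{B},\mathbb{Q})$ with expectation operator $\mathbb{E}$. The random walk is $X_0=0$, $X_n=Y_1+\dots+Y_n$, with running maximum $\bar X_n=\max_{0\le m\le n}X_m$ and running minimum $\underline X_n=\min_{0\le m\le n}X_m$. For $q\in(0,1)$, $T_q$ is a random variable independent of $X$ with $\mathbb{Q}[T_q=n]=(1-q)q^n$, $n=0,1,2,\dots$. The expected present value operators act on functions $u$ (for which the expectations are defined) by $$\mathcal{E}_q u(x)=\mathbb{E}[u(x+X_{T_q})],\quad \mathcal{E}^+_q u(x)=\mathbb{E}[u(x+\bar X_{T_q})],\quad \mathcal{E}^-_q u(x)=\mathbb{E}[u(x+\underline X_{T_q})].$$ $I$ is the identity operator, and $(\mathcal{E}\otimes I)g$ denotes the result of applying the operator $\mathcal{E}$ to $g(x_1,x_2)$ in the first argument, $x_2$ being fixed. $f_+:\mathbb{R}^2\to\mathbb{R}$ is the extension of $f$ by zero outside $U_+$; $f$ is identified with $f_+$ where needed. For $x_1\le x_2$, $$V(f;n;x_1,x_2)=\mathbb{E}[f(x_1+X_n,\max\{x_2,x_1+\bar X_n\})],\qquad \tilde V(f;q;x_1,x_2)=\sum_{n=0}^{\infty}q^n V(f;n;x_1,x_2).$$ *)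

theory Defs
  imports "HOL-Probability.Probability" "HOL-Complex_Analysis.Complex_Analysis"
begin

definition walk :: "(nat \<Rightarrow> 'a \<Rightarrow> real) \<Rightarrow> nat \<Rightarrow> 'a \<Rightarrow> real" where
  "walk Y n \<omega> = (\<Sum>i = 1..n. Y i \<omega>)"

definition walk_max :: "(nat \<Rightarrow> 'a \<Rightarrow> real) \<Rightarrow> nat \<Rightarrow> 'a \<Rightarrow> real" where
  "walk_max Y n \<omega> = Max ((\<lambda>m. walk Y m \<omega>) ` {0..n})"

definition walk_min :: "(nat \<Rightarrow> 'a \<Rightarrow> real) \<Rightarrow> nat \<Rightarrow> 'a \<Rightarrow> real" where
  "walk_min Y n \<omega> = Min ((\<lambda>m. walk Y m \<omega>) ` {0..n})"

text \<open>The steps are \<open>Y 1, Y 2, \<dots>\<close>; \<open>Y 0\<close> is never used and is left unconstrained.\<close>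

definition iid_steps :: "'a measure \<Rightarrow> (nat \<Rightarrow> 'a \<Rightarrow> real) \<Rightarrow> bool" where
  "iid_steps M Y \<longleftrightarrow>
     prob_space.indep_vars M (\<lambda>_. borel) Y {1..} \<and>
     (\<forall>i\<ge>1. \<forall>j\<ge>1. distr M borel (Y i) = distr M borel (Y j))"

text \<open>Independence of \<open>T\<close> from the whole process is independence of the generated
  sigma-algebras; \<open>indep_var\<close> cannot be used because it requires both random variables
  to have the same value type.\<close>

definition geometric_time ::
    "'a measure \<Rightarrow> (nat \<Rightarrow> 'a \<Rightarrow> real) \<Rightarrow> real \<Rightarrow> ('a \<Rightarrow> nat) \<Rightarrow> bool" where
  "geometric_time M Y q T \<longleftrightarrow>
     T \<in> measurable M (count_space UNIV) \<and>
     (\<forall>n. measure M {\<omega> \<in> space M. T \<omega> = n} = (1 - q) * q ^ n) \<and>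
     prob_space.indep_set M
       (sets (vimage_algebra (space M) T (count_space UNIV)))
       (sets (vimage_algebra (space M) (\<lambda>\<omega> n. walk Y n \<omega>) (Pi\<^sub>M UNIV (\<lambda>_. borel))))"

text \<open>The expected present value operators. The parameter \<open>q\<close> enters through \<open>T\<close>, the
  geometric time with parameter \<open>q\<close>.\<close>

definition epv ::
    "'a measure \<Rightarrow> (nat \<Rightarrow> 'a \<Rightarrow> real) \<Rightarrow> ('a \<Rightarrow> nat) \<Rightarrow> (real \<Rightarrow> real) \<Rightarrow> real \<Rightarrow> real" where
  "epv M Y T u x = (LINT \<omega>|M. u (x + walk Y (T \<omega>) \<omega>))"

definition epv_sup ::
    "'a measure \<Rightarrow> (nat \<Rightarrow> 'a \<Rightarrow> real) \<Rightarrow> ('a \<Rightarrow> nat) \<Rightarrow> (real \<Rightarrow> real) \<Rightarrow> real \<Rightarrow> real" where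
  "epv_sup M Y T u x = (LINT \<omega>|M. u (x + walk_max Y (T \<omega>) \<omega>))"

definition epv_inf ::
    "'a measure \<Rightarrow> (nat \<Rightarrow> 'a \<Rightarrow> real) \<Rightarrow> ('a \<Rightarrow> nat) \<Rightarrow> (real \<Rightarrow> real) \<Rightarrow> real \<Rightarrow> real" where
  "epv_inf M Y T u x = (LINT \<omega>|M. u (x + walk_min Y (T \<omega>) \<omega>))"

definition tensor_I ::
    "((real \<Rightarrow> real) \<Rightarrow> real \<Rightarrow> real) \<Rightarrow> (real \<times> real \<Rightarrow> real) \<Rightarrow> real \<times> real \<Rightarrow> real" where
  "tensor_I A g = (\<lambda>(x1, x2). A (\<lambda>x. g (x, x2)) x1)"

definition U_plus :: "(real \<times> real) set" where
  "U_plus = {(x1, x2). 0 \<le> x2 \<and> x1 \<le> x2}"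

text \<open>A function on \<open>U_plus\<close> is represented by a total function whose values outside
  \<open>U_plus\<close> are irrelevant: everything below depends on it only through its extension by zero.\<close>

definition ext_zero :: "(real \<times> real \<Rightarrow> real) \<Rightarrow> real \<times> real \<Rightarrow> real" where
  "ext_zero f p = (if p \<in> U_plus then f p else 0)"

definition V ::
    "'a measure \<Rightarrow> (nat \<Rightarrow> 'a \<Rightarrow> real) \<Rightarrow> (real \<times> real \<Rightarrow> real) \<Rightarrow> nat \<Rightarrow> real \<Rightarrow> real \<Rightarrow> real" where
  "V M Y f n x1 x2 =
     (LINT \<omega>|M. ext_zero f (x1 + walk Y n \<omega>, max x2 (x1 + walk_max Y n \<omega>)))"

definition V_tilde ::
    "'a measure \<Rightarrow> (nat \<Rightarrow> 'a \<Rightarrow> real) \<Rightarrow> (real \<times> real \<Rightarrow> real) \<Rightarrow> real \<Rightarrow> real \<Rightarrow> real \<Rightarrow> real" where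
  "V_tilde M Y f q x1 x2 = (\<Sum>n. q ^ n * V M Y f n x1 x2)"

definition w ::
    "'a measure \<Rightarrow> (nat \<Rightarrow> 'a \<Rightarrow> real) \<Rightarrow> ('a \<Rightarrow> nat) \<Rightarrow> (real \<times> real \<Rightarrow> real) \<Rightarrow> real \<Rightarrow> real \<Rightarrow> real" where
  "w M Y T f y x2 = indicat_real {x2..} y *
     (tensor_I (epv_inf M Y T) (ext_zero f) (y, y)
      - tensor_I (epv_inf M Y T) (ext_zero f) (y, x2))"

end

theory Submission
  imports Defs
begin

text \<open>
  At the independent geometric time \<open>T\<close>, conditioning on whether the running maximum reaches
  \<open>x2\<close> splits the payoff into the \<open>epv\<close> term and a correction that depends only on
  \<open>walk_max T\<close> and the drawdown \<open>walk T - walk_max T\<close>. The Wiener-Hopf factorization says that these two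
  variables are independent and that the drawdown is distributed as \<open>walk_min T\<close>; Fubini then turns
  the correction into \<open>epv_sup w\<close>. Independence comes from splitting a path at the first time \<open>j\<close> at
  which it attains its maximum: the law of (maximum, drawdown) at time \<open>n\<close> is a convolution in \<open>n\<close>
  of a law of the path before \<open>j\<close> and a law of the path after \<open>j\<close>, so its generating function in
  \<open>q\<close> is a product. The law of the drawdown comes from reversing the order of the first \<open>n\<close> steps.
\<close>

section \<open>Measurability of the walk and of its running extrema\<close>

lemma (in prob_space) iid_steps_measurable:
  assumes "iid_steps M Y" "1 \<le> i"
  shows "Y i \<in> borel_measurable M"
  using assms by (auto simp: iid_steps_def indep_vars_def)

lemma (in prob_space) walk_measurable:
  assumes "iid_steps M Y"
  shows "walk Y n \<in> borel_measurable M"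
proof -
  have "(\<lambda>\<omega>. \<Sum>i = 1..n. Y i \<omega>) \<in> borel_measurable M"
    using iid_steps_measurable[OF assms] by (intro borel_measurable_sum) auto
  then show ?thesis
    by (simp add: walk_def[abs_def])
qed

lemma (in prob_space) walk_path_measurable:
  assumes "iid_steps M Y"
  shows "(\<lambda>\<omega> n. walk Y n \<omega>) \<in> measurable M (Pi\<^sub>M UNIV (\<lambda>_. borel))"
  by (rule measurable_PiM_single') (auto intro: walk_measurable[OF assms])

lemma (in prob_space) walk_max_measurable:
  assumes "iid_steps M Y"
  shows "walk_max Y n \<in> borel_measurable M"
  unfolding walk_max_def[abs_def] by (intro borel_measurable_Max walk_measurable assms) auto

lemma (in prob_space) walk_min_measurable:
  assumes "iid_steps M Y"
  shows "walk_min Y n \<in> borel_measurable M"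
  unfolding walk_min_def[abs_def] by (intro borel_measurable_Min walk_measurable assms) auto

section \<open>Joint laws and independence of blocks of steps\<close>

lemma (in prob_space) indep_vars_reindex:
  assumes ind: "indep_vars M' X (f ` I)" and inj: "inj_on f I"
  shows "indep_vars (M' \<circ> f) (X \<circ> f) I"
proof -
  let ?S = "\<lambda>i. {X i -` A \<inter> space M |A. A \<in> sets (M' i)}"
  have "indep_sets (\<lambda>i. ?S (f i)) I"
  proof (rule indep_setsI)
    fix i assume "i \<in> I"
    with ind show "?S (f i) \<subseteq> events"
      by (auto simp: indep_vars_def2 intro: measurable_sets)
  next
    fix A J assume J: "J \<noteq> {}" "J \<subseteq> I" "finite J" and A: "\<forall>j\<in>J. A j \<in> ?S (f j)"
    have inv: "inv_into J f (f j) = j" if "j \<in> J" for j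
      using inv_into_f_f[OF inj_on_subset[OF inj J(2)] that] .
    \<comment> \<open>The events are indexed by \<open>J\<close>; \<open>inv_into J f\<close>
      transports them to the image, where the given independence applies.\<close>
    have "prob (\<Inter>i\<in>f ` J. A (inv_into J f i)) = (\<Prod>i\<in>f ` J. prob (A (inv_into J f i)))"
    proof (rule indep_setsD[of ?S "f ` I"])
      show "indep_sets ?S (f ` I)"
        using ind by (simp add: indep_vars_def2)
      show "\<forall>i\<in>f ` J. A (inv_into J f i) \<in> ?S i"
        using A by (simp add: inv)
    qed (use J in auto)
    moreover have "(\<Prod>i\<in>f ` J. prob (A (inv_into J f i))) = (\<Prod>j\<in>J. prob (A j))"
      by (subst prod.reindex[OF inj_on_subset[OF inj J(2)]]) (simp add: inv)
    ultimately show "prob (\<Inter>j\<in>J. A j) = (\<Prod>j\<in>J. prob (A j))"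
      by (simp add: inv)
  qed
  with ind show ?thesis
    by (auto simp: indep_vars_def2)
qed

text \<open>Any \<open>k\<close> distinct steps, in any order, have as joint law the product of
  \<open>k\<close> copies of the law of \<open>Y 1\<close>. Below, \<pi> is either a shift or the
  reversal of the first \<open>n\<close> steps.\<close>

lemma (in prob_space) iid_steps_block_law:
  assumes iid: "iid_steps M Y" and inj: "inj_on \<pi> {1..k}" and pos: "\<pi> ` {1..k} \<subseteq> {1..}"
  shows "distr M (Pi\<^sub>M {1..k} (\<lambda>_. borel)) (\<lambda>\<omega>. \<lambda>i\<in>{1..k}. Y (\<pi> i) \<omega>) =
    distr M (Pi\<^sub>M {1..k} (\<lambda>_. borel)) (\<lambda>\<omega>. \<lambda>i\<in>{1..k}. Y i \<omega>)"
\<comment> \<open>The product criterion for independence needs a nonempty index set. For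
  \<open>k = 0\<close> both step vectors are the same constant function.\<close>
proof (cases "k = 0")
  case False
  have law: "distr M (Pi\<^sub>M {1..k} (\<lambda>_. borel)) (\<lambda>\<omega>. \<lambda>i\<in>{1..k}. Y (\<sigma> i) \<omega>) =
    Pi\<^sub>M {1..k} (\<lambda>_. distr M borel (Y 1))"
    if "inj_on \<sigma> {1..k}" "\<sigma> ` {1..k} \<subseteq> {1..}" for \<sigma>
  proof -
    have "indep_vars (\<lambda>_. borel) Y (\<sigma> ` {1..k})"
      using iid that(2) by (auto simp: iid_steps_def intro: indep_vars_subset)
    then have "indep_vars ((\<lambda>_. borel) \<circ> \<sigma>) (Y \<circ> \<sigma>) {1..k}"
      using that(1) by (intro indep_vars_reindex)
    then have "indep_vars (\<lambda>_. borel) (\<lambda>i. Y (\<sigma> i)) {1..k}"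
      by (simp add: comp_def)
    moreover have "Y (\<sigma> i) \<in> borel_measurable M" if "i \<in> {1..k}" for i
      using that \<open>\<sigma> ` {1..k} \<subseteq> {1..}\<close>
      by (intro iid_steps_measurable[OF iid]) (simp add: image_subset_iff)
    ultimately have "distr M (Pi\<^sub>M {1..k} (\<lambda>_. borel)) (\<lambda>\<omega>. \<lambda>i\<in>{1..k}. Y (\<sigma> i) \<omega>) =
      Pi\<^sub>M {1..k} (\<lambda>i. distr M borel (Y (\<sigma> i)))"
      using False indep_vars_iff_distr_eq_PiM'[where I="{1..k}" and X="\<lambda>i. Y (\<sigma> i)" and M'="\<lambda>_. borel"] by auto
    also have "\<dots> = Pi\<^sub>M {1..k} (\<lambda>_. distr M borel (Y 1))"
      using iid that(2) by (intro PiM_cong) (auto simp: iid_steps_def image_subset_iff)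
    finally show ?thesis .
  qed
  show ?thesis
    using law[OF inj pos] law[of "\<lambda>i. i"] by auto
qed (simp add: restrict_def)

lemma (in prob_space) iid_steps_block_prob:
  assumes iid: "iid_steps M Y" and inj: "inj_on \<pi> {1..k}" and pos: "\<pi> ` {1..k} \<subseteq> {1..}"
    and Q: "Measurable.pred (Pi\<^sub>M {1..k} (\<lambda>_. borel)) Q"
  shows "\<P>(\<omega> in M. Q (\<lambda>i\<in>{1..k}. Y (\<pi> i) \<omega>)) = \<P>(\<omega> in M. Q (\<lambda>i\<in>{1..k}. Y i \<omega>))"
proof -
  let ?P = "Pi\<^sub>M {1..k} (\<lambda>_. borel :: real measure)"
  let ?A = "{x \<in> space ?P. Q x}"
  have "measure (distr M ?P (\<lambda>\<omega>. \<lambda>i\<in>{1..k}. Y (\<sigma> i) \<omega>)) ?A =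
      \<P>(\<omega> in M. Q (\<lambda>i\<in>{1..k}. Y (\<sigma> i) \<omega>))"
    if "\<sigma> ` {1..k} \<subseteq> {1..}" for \<sigma>
  proof -
    have meas: "(\<lambda>\<omega>. \<lambda>i\<in>{1..k}. Y (\<sigma> i) \<omega>) \<in> measurable M ?P"
      using that
      by (intro measurable_restrict iid_steps_measurable[OF iid]) (simp add: image_subset_iff)
    have "(\<lambda>\<omega>. \<lambda>i\<in>{1..k}. Y (\<sigma> i) \<omega>) -` ?A \<inter> space M =
        {\<omega> \<in> space M. Q (\<lambda>i\<in>{1..k}. Y (\<sigma> i) \<omega>)}"
      using measurable_space[OF meas] by auto
    then show ?thesis
      using Q by (subst measure_distr[OF meas]) auto
  qed
  from this[OF pos] this[of "\<lambda>i. i"] show ?thesis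
    unfolding iid_steps_block_law[OF iid inj pos] by auto
qed

text \<open>The two blocks use disjoint sets of steps, hence are independent; stationarity then lets
  the second block be replaced by one that starts at the first step. This is the Markov property at
  the fixed time \<open>j\<close>.\<close>

lemma (in prob_space) iid_steps_consecutive_blocks:
  assumes iid: "iid_steps M Y"
    and P: "Measurable.pred (Pi\<^sub>M {1..j} (\<lambda>_. borel)) P"
    and Q: "Measurable.pred (Pi\<^sub>M {1..k} (\<lambda>_. borel)) Q"
  shows "\<P>(\<omega> in M. P (\<lambda>i\<in>{1..j}. Y i \<omega>) \<and> Q (\<lambda>i\<in>{1..k}. Y (j + i) \<omega>)) =
    \<P>(\<omega> in M. P (\<lambda>i\<in>{1..j}. Y i \<omega>)) * \<P>(\<omega> in M. Q (\<lambda>i\<in>{1..k}. Y i \<omega>))"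
proof -
  let ?A = "\<lambda>\<omega>. \<lambda>i\<in>{1..j}. Y i \<omega>" and ?B = "\<lambda>\<omega>. \<lambda>i\<in>{j+1..j+k}. Y i \<omega>"
  let ?PA = "Pi\<^sub>M {1..j} (\<lambda>_. borel :: real measure)" and ?PB = "Pi\<^sub>M {j+1..j+k} (\<lambda>_. borel :: real measure)"
  \<comment> \<open>Relabels the coordinates \<open>j+1..j+k\<close> as \<open>1..k\<close>, the
    index set on which \<open>Q\<close> is defined.\<close>
  let ?sh = "\<lambda>x::nat \<Rightarrow> real. \<lambda>i\<in>{1..k}. x (j + i)"
  have ind: "indep_var ?PA ?A ?PB ?B"
    using iid by (intro indep_var_restrict[where I="{1..}"]) (auto simp: iid_steps_def)
  have sh: "?sh \<in> measurable ?PB (Pi\<^sub>M {1..k} (\<lambda>_. borel))"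
    by (intro measurable_restrict measurable_component_singleton) auto
  have sh_B: "?sh (?B \<omega>) = (\<lambda>i\<in>{1..k}. Y (j + i) \<omega>)" for \<omega>
    by (auto simp: restrict_def)
  let ?XA = "{x \<in> space ?PA. P x}" and ?XB = "{x \<in> space ?PB. Q (?sh x)}"
  have XB: "?XB \<in> sets ?PB"
    using measurable_compose[OF sh Q] by simp
  have "prob ((\<lambda>\<omega>. (?A \<omega>, ?B \<omega>)) -` (?XA \<times> ?XB) \<inter> space M) =
      prob (?A -` ?XA \<inter> space M) * prob (?B -` ?XB \<inter> space M)"
    using P XB by (intro indep_varD[OF ind]) auto
  moreover have "(\<lambda>\<omega>. (?A \<omega>, ?B \<omega>)) -` (?XA \<times> ?XB) \<inter> space M =
      {\<omega> \<in> space M. P (?A \<omega>) \<and> Q (?sh (?B \<omega>))}"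
    "?A -` ?XA \<inter> space M = {\<omega> \<in> space M. P (?A \<omega>)}"
    "?B -` ?XB \<inter> space M = {\<omega> \<in> space M. Q (?sh (?B \<omega>))}"
    using measurable_space[OF indep_var_rv1[OF ind]] measurable_space[OF indep_var_rv2[OF ind]]
    by auto
  moreover have "\<P>(\<omega> in M. Q (\<lambda>i\<in>{1..k}. Y (j + i) \<omega>)) = \<P>(\<omega> in M. Q (\<lambda>i\<in>{1..k}. Y i \<omega>))"
    using iid_steps_block_prob[OF iid, of "\<lambda>i. j + i" k Q] Q by (auto simp: inj_on_def)
  ultimately show ?thesis
    unfolding sh_B by simp
qed

section \<open>Shifting and reversing a path\<close>

text \<open>\<open>walk (\<lambda>i x. x i)\<close> is the walk on the coordinate space of step
  vectors. Through it, path events become predicates on a finite block of steps, to which the block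
  lemmas apply.\<close>

lemma walk_restrict:
  assumes "m \<le> k"
  shows "walk (\<lambda>i x. x i) m (\<lambda>i\<in>{1..k}. Y i \<omega>) = walk Y m \<omega>"
  using assms by (simp add: walk_def)

lemma walk_shift:
  "walk (\<lambda>i. Y (j + i)) m \<omega> = walk Y (j + m) \<omega> - walk Y j \<omega>"
  by (induction m) (simp_all add: walk_def)

lemma walk_reverse:
  assumes "m \<le> n"
  shows "walk (\<lambda>i. Y (n + 1 - i)) m \<omega> = walk Y n \<omega> - walk Y (n - m) \<omega>"
  using assms
proof (induction m)
  case (Suc m)
  from Suc.prems have "n - m = Suc (n - Suc m)"
    by simp
  then have "walk Y (n - m) \<omega> = walk Y (n - Suc m) \<omega> + Y (n - m) \<omega>"
    by (simp only: walk_def sum.cl_ivl_Suc) simp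
  with Suc show ?case
    by (simp add: walk_def)
qed (simp add: walk_def)

lemma walk_coordinates_measurable:
  assumes "m \<le> k"
  shows "walk (\<lambda>i x. x i) m \<in> borel_measurable (Pi\<^sub>M {1..k} (\<lambda>_. borel))"
  unfolding walk_def[abs_def] using assms
  by (intro borel_measurable_sum measurable_component_singleton) auto

text \<open>After \<open>m\<close> reversed steps the walk stands at the final value minus the
  original value at time \<open>n - m\<close>; minimizing over \<open>m\<close> therefore maximizes
  the subtracted value.\<close>

lemma walk_min_reverse:
  "walk_min (\<lambda>i. Y (n + 1 - i)) n \<omega> = walk Y n \<omega> - walk_max Y n \<omega>"
proof -
  let ?S = "(\<lambda>m. walk Y m \<omega>) ` {0..n}"
  have "(\<lambda>m. walk (\<lambda>i. Y (n + 1 - i)) m \<omega>) ` {0..n} = (\<lambda>m. walk Y n \<omega> - walk Y (n - m) \<omega>) ` {0..n}"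
    by (intro image_cong refl walk_reverse) auto
  also have "\<dots> = (\<lambda>s. walk Y n \<omega> - s) ` (\<lambda>m. walk Y m \<omega>) ` (\<lambda>m. n - m) ` {0..n}"
    by (simp add: image_image)
  also have "(\<lambda>m. n - m) ` {0..n} = {0..n}"
  proof (intro equalityI subsetI)
    fix m assume "m \<in> {0..n}"
    then show "m \<in> (\<lambda>m. n - m) ` {0..n}"
      by (intro image_eqI[of _ _ "n - m"]) auto
  qed auto
  finally have "walk_min (\<lambda>i. Y (n + 1 - i)) n \<omega> = Min ((\<lambda>s. walk Y n \<omega> - s) ` ?S)"
    by (simp add: walk_min_def)
  also have "\<dots> = walk Y n \<omega> - Max ?S"
  proof (rule Min_eqI)
    show "walk Y n \<omega> - Max ?S \<in> (\<lambda>s. walk Y n \<omega> - s) ` ?S"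
      by (intro imageI Max_in) auto
  qed auto
  finally show ?thesis
    by (simp add: walk_max_def)
qed

text \<open>The drawdown is the running minimum of the walk with reversed steps, and reversing the
  first \<open>n\<close> steps does not change their joint law.\<close>

lemma (in prob_space) drawdown_law:
  assumes iid: "iid_steps M Y" and F: "F \<in> sets borel"
  shows "\<P>(\<omega> in M. walk Y n \<omega> - walk_max Y n \<omega> \<in> F) = \<P>(\<omega> in M. walk_min Y n \<omega> \<in> F)"
proof -
  let ?Q = "\<lambda>x. walk_min (\<lambda>i x. x i) n x \<in> F"
  have Q: "Measurable.pred (Pi\<^sub>M {1..n} (\<lambda>_. borel)) ?Q"
  proof (rule pred_sets2[OF F])
    show "walk_min (\<lambda>i x. x i) n \<in> borel_measurable (Pi\<^sub>M {1..n} (\<lambda>_. borel))"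
      unfolding walk_min_def[abs_def]
      by (intro borel_measurable_Min walk_coordinates_measurable) auto
  qed
  have eq: "walk_min (\<lambda>i x. x i) n (\<lambda>i\<in>{1..n}. Z i \<omega>) = walk_min Z n \<omega>" for Z and \<omega> :: 'a
    unfolding walk_min_def by (intro arg_cong[where f=Min] image_cong walk_restrict) auto
  have "inj_on (\<lambda>i. n + 1 - i) {1..n}" "(\<lambda>i. n + 1 - i) ` {1..n} \<subseteq> {1..}"
    by (auto simp: inj_on_def)
  from iid_steps_block_prob[OF iid this Q] show ?thesis
    unfolding eq[of "\<lambda>i. Y (n + 1 - i)"] eq walk_min_reverse .
qed

section \<open>Decomposition of the path at its first maximum\<close>

lemma walk_le_walk_max: "m \<le> n \<Longrightarrow> walk Y m \<omega> \<le> walk_max Y n \<omega>"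
  by (simp add: walk_max_def)

lemma walk_max_attained: "\<exists>m\<le>n. walk_max Y n \<omega> = walk Y m \<omega>"
proof -
  have "walk_max Y n \<omega> \<in> (\<lambda>m. walk Y m \<omega>) ` {0..n}"
    unfolding walk_max_def by (intro Max_in) auto
  then show ?thesis
    by auto
qed

text \<open>The probability of a strict ascending record at time \<open>j\<close> with value in
  \<open>E\<close>. Strict inequalities here and weak ones in \<open>nonpos_prob\<close> assign a
  maximum that is attained several times to its first occurrence.\<close>

definition record_prob :: "'a measure \<Rightarrow> (nat \<Rightarrow> 'a \<Rightarrow> real) \<Rightarrow> real set \<Rightarrow> nat \<Rightarrow> real" where
  "record_prob M Y E j = \<P>(\<omega> in M. walk Y j \<omega> \<in> E \<and> (\<forall>i<j. walk Y i \<omega> < walk Y j \<omega>))"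

definition nonpos_prob :: "'a measure \<Rightarrow> (nat \<Rightarrow> 'a \<Rightarrow> real) \<Rightarrow> real set \<Rightarrow> nat \<Rightarrow> real" where
  "nonpos_prob M Y F k = \<P>(\<omega> in M. walk Y k \<omega> \<in> F \<and> (\<forall>i\<le>k. walk Y i \<omega> \<le> 0))"

text \<open>If the maximum is first attained at \<open>j\<close>, then its value depends on the
  first \<open>j\<close> steps only and the drawdown on the remaining \<open>n - j\<close> only.
  Summing over \<open>j\<close> the products of these independent contributions gives a
  convolution.\<close>

lemma (in prob_space) split_at_first_maximum:
  assumes iid: "iid_steps M Y" and E: "E \<in> sets borel" and F: "F \<in> sets borel"
  shows "\<P>(\<omega> in M. walk_max Y n \<omega> \<in> E \<and> walk Y n \<omega> - walk_max Y n \<omega> \<in> F) =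
    (\<Sum>j\<le>n. record_prob M Y E j * nonpos_prob M Y F (n - j))"
proof -
  note [measurable] = walk_measurable[OF iid] E F
  let ?X = "\<lambda>m \<omega>. walk Y m \<omega>"
  let ?A = "\<lambda>j \<omega>. ?X j \<omega> \<in> E \<and> (\<forall>i<j. ?X i \<omega> < ?X j \<omega>)"
  let ?B = "\<lambda>j \<omega>. ?X n \<omega> - ?X j \<omega> \<in> F \<and> (\<forall>i\<le>n - j. ?X (j + i) \<omega> - ?X j \<omega> \<le> 0)"
  \<comment> \<open>\<open>D j\<close> is the part of the event on which \<open>j\<close> is the
    first time of the maximum.\<close>
  define D where "D j = {\<omega> \<in> space M. ?A j \<omega> \<and> ?B j \<omega>}" for j
  have D_sets: "D j \<in> events" for j
    unfolding D_def by measurable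
  have max_D: "walk_max Y n \<omega> = ?X j \<omega>" if "\<omega> \<in> D j" "j \<le> n" for \<omega> j
    unfolding walk_max_def
  proof (rule Max_eqI)
    fix s assume "s \<in> (\<lambda>m. ?X m \<omega>) ` {0..n}"
    then obtain m where m: "m \<le> n" "s = ?X m \<omega>"
      by auto
    show "s \<le> ?X j \<omega>"
    proof (cases "m < j")
      case False
      then have "j + (m - j) = m" "m - j \<le> n - j"
        using m by auto
      then show ?thesis
        using that(1) m(2) by (auto simp: D_def)
    qed (use that m in \<open>simp add: D_def less_imp_le\<close>)
  qed (use that in auto)
  have "{\<omega> \<in> space M. walk_max Y n \<omega> \<in> E \<and> ?X n \<omega> - walk_max Y n \<omega> \<in> F} = (\<Union>j\<le>n. D j)"
  proof (intro equalityI subsetI)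
    fix \<omega> assume \<omega>: "\<omega> \<in> {\<omega> \<in> space M. walk_max Y n \<omega> \<in> E \<and> ?X n \<omega> - walk_max Y n \<omega> \<in> F}"
    define j where "j = (LEAST m. walk_max Y n \<omega> = ?X m \<omega>)"
    obtain m where m: "m \<le> n" "walk_max Y n \<omega> = ?X m \<omega>"
      using walk_max_attained[of n Y \<omega>] by auto
    have j: "walk_max Y n \<omega> = ?X j \<omega>"
      unfolding j_def by (rule LeastI[where P="\<lambda>m. walk_max Y n \<omega> = ?X m \<omega>", OF m(2)])
    have "j \<le> n"
      using Least_le[of "\<lambda>m. walk_max Y n \<omega> = ?X m \<omega>", OF m(2)] m(1) by (simp only: j_def)
    have "?X i \<omega> < ?X j \<omega>" if "i < j" for i
    proof -
      have "walk_max Y n \<omega> \<noteq> ?X i \<omega>"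
        by (rule not_less_Least) (rule that[unfolded j_def])
      moreover have "?X i \<omega> \<le> walk_max Y n \<omega>"
        using that \<open>j \<le> n\<close> by (intro walk_le_walk_max) simp
      ultimately show ?thesis
        using j by linarith
    qed
    moreover have "?X (j + i) \<omega> - ?X j \<omega> \<le> 0" if "i \<le> n - j" for i
      using walk_le_walk_max[of "j + i" n Y \<omega>] that \<open>j \<le> n\<close> j by auto
    ultimately have "\<omega> \<in> D j"
      using \<omega> j by (auto simp: D_def)
    with \<open>j \<le> n\<close> show "\<omega> \<in> (\<Union>j\<le>n. D j)"
      by auto
  next
    fix \<omega> assume "\<omega> \<in> (\<Union>j\<le>n. D j)"
    then obtain j where j: "j \<le> n" "\<omega> \<in> D j"
      by auto
    from max_D[OF j(2,1)] j(2)
    show "\<omega> \<in> {\<omega> \<in> space M. walk_max Y n \<omega> \<in> E \<and> ?X n \<omega> - walk_max Y n \<omega> \<in> F}"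
      by (simp add: D_def)
  qed
  \<comment> \<open>For \<open>j < k\<close>, being in \<open>D k\<close> forces the value at
    \<open>j\<close> strictly below that at \<open>k\<close>, while being in \<open>D j\<close>
    forces the opposite weak inequality.\<close>
  moreover have "disjoint_family_on D {..n}"
  proof -
    have "D j \<inter> D k = {}" if "j < k" "k \<le> n" for j k
    proof -
      have False if "\<omega> \<in> D j" "\<omega> \<in> D k" for \<omega>
      proof -
        have "?X j \<omega> < ?X k \<omega>"
          using that(2) \<open>j < k\<close> by (simp add: D_def)
        moreover have "?X (j + (k - j)) \<omega> - ?X j \<omega> \<le> 0"
          using that(1) \<open>k \<le> n\<close> diff_le_mono[of k n j] by (simp add: D_def del: le_add_diff_inverse)
        ultimately show False
          using \<open>j < k\<close> by simp
      qed
      then show ?thesis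
        by auto
    qed
    then show ?thesis
      unfolding disjoint_family_on_def by (metis atMost_iff inf_commute linorder_neqE_nat)
  qed
  ultimately have "\<P>(\<omega> in M. walk_max Y n \<omega> \<in> E \<and> ?X n \<omega> - walk_max Y n \<omega> \<in> F) =
      (\<Sum>j\<le>n. prob (D j))"
    using D_sets by (simp add: finite_measure_finite_Union image_subset_iff)
  also have "\<dots> = (\<Sum>j\<le>n. record_prob M Y E j * nonpos_prob M Y F (n - j))"
  proof (rule sum.cong)
    fix j assume "j \<in> {..n}"
    \<comment> \<open>Both conditions are restated on step vectors, with quantifiers over finite
      sets so that measurability follows from finite intersections.\<close>
    let ?W = "walk (\<lambda>i x. x i)"
    let ?P = "\<lambda>x. ?W j x \<in> E \<and> (\<forall>i\<in>{..<j}. ?W i x < ?W j x)"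
    let ?Q = "\<lambda>x. ?W (n - j) x \<in> F \<and> (\<forall>i\<in>{..n - j}. ?W i x \<le> 0)"
    have meas: "?W m \<in> borel_measurable (Pi\<^sub>M {1..k} (\<lambda>_. borel))" if "m \<le> k" for m k
      using walk_coordinates_measurable[OF that] .
    have P: "Measurable.pred (Pi\<^sub>M {1..j} (\<lambda>_. borel)) ?P"
      by (intro pred_intros_logic pred_intros_finite pred_sets2[OF E] borel_measurable_pred_less meas) auto
    have Q: "Measurable.pred (Pi\<^sub>M {1..n - j} (\<lambda>_. borel)) ?Q"
      by (intro pred_intros_logic pred_intros_finite pred_sets2[OF F]
          borel_measurable_le[folded Measurable.pred_def] borel_measurable_const meas) auto
    have PY: "?P (\<lambda>i\<in>{1..j}. Y i \<omega>) \<longleftrightarrow> ?A j \<omega>" for \<omega>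
      by (auto simp: walk_restrict simp del: One_nat_def)
    have QZ: "?Q (\<lambda>i\<in>{1..n - j}. Z i \<omega>) \<longleftrightarrow>
        walk Z (n - j) \<omega> \<in> F \<and> (\<forall>i\<le>n - j. walk Z i \<omega> \<le> 0)" for Z and \<omega> :: 'a
      by (auto simp: walk_restrict simp del: One_nat_def)
    have "prob (D j) =
        \<P>(\<omega> in M. ?P (\<lambda>i\<in>{1..j}. Y i \<omega>) \<and> ?Q (\<lambda>i\<in>{1..n - j}. Y (j + i) \<omega>))"
      using \<open>j \<in> {..n}\<close> unfolding PY QZ[of "\<lambda>i. Y (j + i)"] walk_shift by (simp add: D_def)
    also have "\<dots> = \<P>(\<omega> in M. ?P (\<lambda>i\<in>{1..j}. Y i \<omega>)) * \<P>(\<omega> in M. ?Q (\<lambda>i\<in>{1..n - j}. Y i \<omega>))"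
      by (rule iid_steps_consecutive_blocks[OF iid P Q])
    also have "\<dots> = record_prob M Y E j * nonpos_prob M Y F (n - j)"
      unfolding PY QZ record_prob_def nonpos_prob_def ..
    finally show "prob (D j) = record_prob M Y E j * nonpos_prob M Y F (n - j)" .
  qed simp
  finally show ?thesis .
qed

section \<open>Sampling path functionals at the geometric time\<close>

text \<open>Decompose by the value of \<open>T\<close>: independence from the path factors each
  term, and boundedness justifies the interchange of sum and expectation. Taking \<psi> as a
  function of the whole path matches the sigma-algebra in \<open>geometric_time\<close>.\<close>

lemma (in prob_space) geometric_time_expectation:
  fixes \<psi> :: "nat \<Rightarrow> (nat \<Rightarrow> real) \<Rightarrow> real"
  assumes iid: "iid_steps M Y" and T: "geometric_time M Y q T"
    and meas: "\<And>n. \<psi> n \<in> borel_measurable (Pi\<^sub>M UNIV (\<lambda>_. borel))"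
    and bound: "\<And>n p. \<bar>\<psi> n p\<bar> \<le> B"
  shows "(\<lambda>n. (1 - q) * q ^ n * (\<integral>\<omega>. \<psi> n (\<lambda>m. walk Y m \<omega>) \<partial>M)) sums
    (\<integral>\<omega>. \<psi> (T \<omega>) (\<lambda>m. walk Y m \<omega>) \<partial>M)"
proof -
  let ?p = "\<lambda>\<omega> m. walk Y m \<omega>" and ?Path = "Pi\<^sub>M UNIV (\<lambda>_. borel) :: (nat \<Rightarrow> real) measure"
  let ?I = "\<lambda>n. indicat_real {\<omega> \<in> space M. T \<omega> = n}"
  have T_meas[measurable]: "T \<in> measurable M (count_space UNIV)"
    and T_prob: "\<P>(\<omega> in M. T \<omega> = n) = (1 - q) * q ^ n"
    and T_indep: "indep_set (sets (vimage_algebra (space M) T (count_space UNIV)))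
      (sets (vimage_algebra (space M) ?p ?Path))" for n
    using T by (auto simp: geometric_time_def)
  have Z_meas[measurable]: "(\<lambda>\<omega>. \<psi> n (?p \<omega>)) \<in> borel_measurable M" for n
    using measurable_compose[OF walk_path_measurable[OF iid] meas] .
  have T_events: "{\<omega> \<in> space M. T \<omega> = n} \<in> events" for n
    by measurable
  have int: "integrable M (\<lambda>\<omega>. \<psi> n (?p \<omega>))" for n
    using bound by (intro integrable_const_bound[of _ B]) auto
  have I_int: "integrable M (?I n)" for n
    using T_events by (intro integrable_real_indicator) (auto simp: emeasure_eq_measure)
  have indep: "indep_var borel (?I n) borel (\<lambda>\<omega>. \<psi> n (?p \<omega>))" for n
  proof -
    \<comment> \<open>The indicator is a function of \<open>T\<close> and the other variable a
      function of the path, so their sigma-algebras lie inside the two that are independent by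
      hypothesis.\<close>
    have "?I n -` A \<inter> space M \<in> sets (vimage_algebra (space M) T (count_space UNIV))" for A
    proof -
      have "?I n -` A \<inter> space M = T -` {m. (if m = n then 1 else 0) \<in> A} \<inter> space M"
        by (auto simp: indicator_def)
      then show ?thesis
        by (simp only:) (intro in_vimage_algebra, simp)
    qed
    moreover have "(\<lambda>\<omega>. \<psi> n (?p \<omega>)) -` A \<inter> space M \<in> sets (vimage_algebra (space M) ?p ?Path)"
      if "A \<in> sets borel" for A
    proof -
      have "(\<lambda>\<omega>. \<psi> n (?p \<omega>)) -` A \<inter> space M = ?p -` (\<psi> n -` A) \<inter> space M"
        by auto
      then show ?thesis
        using measurable_sets[OF meas that, of n] by (simp add: in_vimage_algebra space_PiM)
    qed
    ultimately have "sigma_sets (space M) {?I n -` A \<inter> space M |A. A \<in> sets borel} \<subseteq>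
        sets (vimage_algebra (space M) T (count_space UNIV))"
      "sigma_sets (space M) {(\<lambda>\<omega>. \<psi> n (?p \<omega>)) -` A \<inter> space M |A. A \<in> sets borel} \<subseteq>
        sets (vimage_algebra (space M) ?p ?Path)"
      using sets.sigma_sets_subset[of _ "vimage_algebra (space M) T (count_space UNIV)"]
        sets.sigma_sets_subset[of _ "vimage_algebra (space M) ?p ?Path"]
      unfolding space_vimage_algebra by (smt (verit) mem_Collect_eq subsetI)+
    then have "indep_set (sigma_sets (space M) {?I n -` A \<inter> space M |A. A \<in> sets borel})
        (sigma_sets (space M) {(\<lambda>\<omega>. \<psi> n (?p \<omega>)) -` A \<inter> space M |A. A \<in> sets borel})"
      using T_indep unfolding indep_sets2_eq by blast
    then show ?thesis
      using T_events by (auto simp: indep_var_eq)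
  qed
  have product: "(\<integral>\<omega>. ?I n \<omega> * \<psi> n (?p \<omega>) \<partial>M) = (1 - q) * q ^ n * (\<integral>\<omega>. \<psi> n (?p \<omega>) \<partial>M)" for n
    using indep_var_lebesgue_integral[OF indep I_int int] T_events T_prob
    by (simp add: Int_absorb2[OF sets.sets_into_space])
  \<comment> \<open>At most one summand is nonzero at each point, so the partial sums are bounded by
    \<open>B\<close> uniformly in \<open>k\<close> and become constant once \<open>k\<close> exceeds
    \<open>T\<close>.\<close>
  let ?s = "\<lambda>k \<omega>. \<Sum>n<k. ?I n \<omega> * \<psi> n (?p \<omega>)"
  have s_eq: "?s k \<omega> = (if T \<omega> < k then \<psi> (T \<omega>) (?p \<omega>) else 0)" if "\<omega> \<in> space M" for k \<omega>
    using that by (auto simp: indicator_def if_distrib[of "\<lambda>c. c * _"] cong: if_cong)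
  have limit_meas: "(\<lambda>\<omega>. \<psi> (T \<omega>) (?p \<omega>)) \<in> borel_measurable M"
    by (rule measurable_compose_countable[OF Z_meas T_meas])
  have "0 \<le> B"
    using bound[of 0 "\<lambda>_. 0"] by linarith
  have "(\<lambda>k. \<integral>\<omega>. ?s k \<omega> \<partial>M) \<longlonglongrightarrow> (\<integral>\<omega>. \<psi> (T \<omega>) (?p \<omega>) \<partial>M)"
  proof (rule integral_dominated_convergence[where w="\<lambda>_. B"])
    show "AE \<omega> in M. (\<lambda>k. ?s k \<omega>) \<longlonglongrightarrow> \<psi> (T \<omega>) (?p \<omega>)"
    proof (rule AE_I2)
      fix \<omega> assume \<omega>: "\<omega> \<in> space M"
      have "\<forall>\<^sub>F k in sequentially. ?s k \<omega> = \<psi> (T \<omega>) (?p \<omega>)"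
        using eventually_gt_at_top[of "T \<omega>"] by eventually_elim (simp add: s_eq[OF \<omega>])
      then show "(\<lambda>k. ?s k \<omega>) \<longlonglongrightarrow> \<psi> (T \<omega>) (?p \<omega>)"
        by (rule tendsto_eventually)
    qed
    show "AE \<omega> in M. norm (?s k \<omega>) \<le> B" for k
    proof (rule AE_I2)
      fix \<omega> assume "\<omega> \<in> space M"
      from s_eq[OF this] show "norm (?s k \<omega>) \<le> B"
        using bound \<open>0 \<le> B\<close> by (simp only: real_norm_def) (simp split: if_split)
    qed
  qed (use limit_meas T_events in auto)
  moreover have "(\<integral>\<omega>. ?s k \<omega> \<partial>M) = (\<Sum>n<k. (1 - q) * q ^ n * (\<integral>\<omega>. \<psi> n (?p \<omega>) \<partial>M))" for k
    by (subst Bochner_Integration.integral_sum[OF indep_var_integrable[OF indep I_int int]])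
      (simp only: product)
  ultimately show ?thesis
    by (simp add: sums_def)
qed

lemma (in prob_space) geometric_time_prob:
  assumes iid: "iid_steps M Y" and T: "geometric_time M Y q T"
    and Q: "\<And>n. Measurable.pred (Pi\<^sub>M UNIV (\<lambda>_. borel)) (Q n)"
  shows "(\<lambda>n. (1 - q) * q ^ n * \<P>(\<omega> in M. Q n (\<lambda>m. walk Y m \<omega>))) sums
    \<P>(\<omega> in M. Q (T \<omega>) (\<lambda>m. walk Y m \<omega>))"
proof -
  have T_meas: "T \<in> measurable M (count_space UNIV)"
    using T by (simp add: geometric_time_def)
  let ?p = "\<lambda>\<omega> m. walk Y m \<omega>"
  have eq: "(\<integral>\<omega>. of_bool (R \<omega>) \<partial>M) = \<P>(\<omega> in M. R \<omega>)" for R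
  proof -
    have "(\<integral>\<omega>. of_bool (R \<omega>) \<partial>M) = (\<integral>\<omega>. indicat_real {\<omega> \<in> space M. R \<omega>} \<omega> \<partial>M)"
      by (intro Bochner_Integration.integral_cong) (auto simp: indicator_def)
    also have "\<dots> = \<P>(\<omega> in M. R \<omega>)"
      by (simp add: Int_absorb2)
    finally show ?thesis .
  qed
  have "(\<lambda>n. (1 - q) * q ^ n * (\<integral>\<omega>. of_bool (Q n (?p \<omega>)) \<partial>M)) sums
    (\<integral>\<omega>. of_bool (Q (T \<omega>) (?p \<omega>)) \<partial>M)"
  proof (rule geometric_time_expectation[OF iid T, where B=1])
    show "(\<lambda>p. of_bool (Q n p)) \<in> borel_measurable (Pi\<^sub>M UNIV (\<lambda>_. borel))" for n
      using Q by (simp add: of_bool_def)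
  qed auto
  then show ?thesis
    by (simp only: eq)
qed

section \<open>The Wiener-Hopf factorization\<close>

text \<open>Weighting the convolution of \<open>split_at_first_maximum\<close> by powers of
  \<open>q\<close> gives a Cauchy product, so the joint probability separates into a factor in
  \<open>E\<close> and a factor in \<open>F\<close>.\<close>

lemma (in prob_space) wiener_hopf_prob:
  assumes iid: "iid_steps M Y" and T: "geometric_time M Y q T" and q: "0 < q" "q < 1"
    and E: "E \<in> sets borel" and F: "F \<in> sets borel"
  shows "\<P>(\<omega> in M. walk_max Y (T \<omega>) \<omega> \<in> E \<and> walk Y (T \<omega>) \<omega> - walk_max Y (T \<omega>) \<omega> \<in> F) =
    (1 - q) * ((\<Sum>j. q ^ j * record_prob M Y E j) * (\<Sum>k. q ^ k * nonpos_prob M Y F k))"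
proof -
  \<comment> \<open>The running maximum is written as a functional of the path \<open>p\<close>, as
    \<open>geometric_time_prob\<close> requires.\<close>
  let ?Q = "\<lambda>(n::nat) p. Max (p ` {0..n}) \<in> E \<and> p n - Max (p ` {0..n}) \<in> F"
  have Max_meas: "(\<lambda>p. Max (p ` {0..n})) \<in> borel_measurable (Pi\<^sub>M UNIV (\<lambda>_. borel :: real measure))"
    for n :: nat
    by (intro borel_measurable_Max measurable_component_singleton) auto
  have Q: "Measurable.pred (Pi\<^sub>M UNIV (\<lambda>_. borel)) (?Q n)" for n
    by (intro pred_intros_logic pred_sets2[OF E] pred_sets2[OF F] Max_meas borel_measurable_diff
        measurable_component_singleton UNIV_I)
  have direct: "(\<lambda>n. (1 - q) * q ^ n * (\<Sum>j\<le>n. record_prob M Y E j * nonpos_prob M Y F (n - j))) sums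
    \<P>(\<omega> in M. walk_max Y (T \<omega>) \<omega> \<in> E \<and> walk Y (T \<omega>) \<omega> - walk_max Y (T \<omega>) \<omega> \<in> F)"
    using geometric_time_prob[OF iid T, of ?Q, OF Q]
    unfolding split_at_first_maximum[OF iid E F, symmetric] walk_max_def .
  have regroup: "(1 - q) * q ^ n * (\<Sum>j\<le>n. record_prob M Y E j * nonpos_prob M Y F (n - j)) =
      (1 - q) * (\<Sum>j\<le>n. (q ^ j * record_prob M Y E j) * (q ^ (n - j) * nonpos_prob M Y F (n - j)))" for n
  proof -
    have "q ^ n = q ^ j * q ^ (n - j)" if "j \<le> n" for j
      using that by (simp flip: power_add)
    then show ?thesis
      by (auto simp: sum_distrib_left intro!: sum.cong)
  qed
  \<comment> \<open>Mertens-type multiplication of the two series needs absolute convergence;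
    probabilities are at most 1, so the geometric series dominates.\<close>
  have "summable (\<lambda>n. norm (q ^ n * a n))" if "\<And>n. 0 \<le> a n" "\<And>n. a n \<le> 1" for a :: "nat \<Rightarrow> real"
  proof (rule summable_comparison_test)
    show "\<exists>N. \<forall>n\<ge>N. norm (norm (q ^ n * a n)) \<le> q ^ n"
      using q that by (auto simp: abs_mult mult_left_le)
  qed (use q in simp)
  then have "summable (\<lambda>j. norm (q ^ j * record_prob M Y E j))"
    "summable (\<lambda>k. norm (q ^ k * nonpos_prob M Y F k))"
    by (simp_all add: record_prob_def nonpos_prob_def)
  from sums_mult[OF Cauchy_product_sums[OF this], of "1 - q"]
  have "(\<lambda>n. (1 - q) * (\<Sum>j\<le>n. (q ^ j * record_prob M Y E j) * (q ^ (n - j) * nonpos_prob M Y F (n - j)))) sums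
    ((1 - q) * ((\<Sum>j. q ^ j * record_prob M Y E j) * (\<Sum>k. q ^ k * nonpos_prob M Y F k)))" .
  with direct show ?thesis
    unfolding regroup by (rule sums_unique2)
qed

lemma (in prob_space) stopped_walk_measurable:
  assumes iid: "iid_steps M Y" and T: "geometric_time M Y q T"
  shows "(\<lambda>\<omega>. walk Y (T \<omega>) \<omega>) \<in> borel_measurable M"
    and "(\<lambda>\<omega>. walk_max Y (T \<omega>) \<omega>) \<in> borel_measurable M"
    and "(\<lambda>\<omega>. walk_min Y (T \<omega>) \<omega>) \<in> borel_measurable M"
proof -
  have T_meas: "T \<in> measurable M (count_space UNIV)"
    using T by (simp add: geometric_time_def)
  show "(\<lambda>\<omega>. walk Y (T \<omega>) \<omega>) \<in> borel_measurable M"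
    by (rule measurable_compose_countable[OF walk_measurable[OF iid] T_meas])
  show "(\<lambda>\<omega>. walk_max Y (T \<omega>) \<omega>) \<in> borel_measurable M"
    by (rule measurable_compose_countable[OF walk_max_measurable[OF iid] T_meas])
  show "(\<lambda>\<omega>. walk_min Y (T \<omega>) \<omega>) \<in> borel_measurable M"
    by (rule measurable_compose_countable[OF walk_min_measurable[OF iid] T_meas])
qed

lemma (in prob_space) wiener_hopf_indep:
  assumes iid: "iid_steps M Y" and T: "geometric_time M Y q T" and q: "0 < q" "q < 1"
  shows "indep_var borel (\<lambda>\<omega>. walk_max Y (T \<omega>) \<omega>)
    borel (\<lambda>\<omega>. walk Y (T \<omega>) \<omega> - walk_max Y (T \<omega>) \<omega>)"
proof -
  let ?X = "\<lambda>\<omega>. walk_max Y (T \<omega>) \<omega>" and ?D = "\<lambda>\<omega>. walk Y (T \<omega>) \<omega> - walk_max Y (T \<omega>) \<omega>"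
  note [measurable] = stopped_walk_measurable[OF iid T]
  have meas: "?X \<in> borel_measurable M" "?D \<in> borel_measurable M"
    by measurable
  define J where "J E F = \<P>(\<omega> in M. ?X \<omega> \<in> E \<and> ?D \<omega> \<in> F)" for E F
  \<comment> \<open>\<open>J E F = c a(E) b(F)\<close> with total mass \<open>J UNIV UNIV = 1\<close>, so \<open>J\<close> is the product of its marginals.\<close>
  have J: "J E F = J E UNIV * J UNIV F" if "E \<in> sets borel" "F \<in> sets borel" for E F
  proof -
    let ?a = "\<lambda>E. \<Sum>j. q ^ j * record_prob M Y E j" and ?b = "\<lambda>F. \<Sum>k. q ^ k * nonpos_prob M Y F k"
    have J_eq: "J E F = (1 - q) * (?a E * ?b F)" if "E \<in> sets borel" "F \<in> sets borel" for E F
      unfolding J_def by (rule wiener_hopf_prob[OF iid T q that])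
    have "J UNIV UNIV = 1"
      by (simp add: J_def prob_space)
    then have "J E F = J E F * J UNIV UNIV"
      by simp
    also have "\<dots> = J E UNIV * J UNIV F"
      using that by (simp add: J_eq)
    finally show ?thesis .
  qed
  let ?G = "\<lambda>Z. {Z -` A \<inter> space M |A. A \<in> sets (borel :: real measure)}"
  have "indep_set (?G ?X) (?G ?D)"
    unfolding indep_sets2_eq
  proof (intro conjI ballI)
    fix a b assume "a \<in> ?G ?X" "b \<in> ?G ?D"
    then obtain E F where EF: "E \<in> sets borel" "F \<in> sets borel"
      and ab: "a = ?X -` E \<inter> space M" "b = ?D -` F \<inter> space M"
      by auto
    have "prob (a \<inter> b) = J E F" "prob a = J E UNIV" "prob b = J UNIV F"
      unfolding J_def ab by (intro arg_cong[where f=prob]; auto)+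
    with J[OF EF] show "prob (a \<inter> b) = prob a * prob b"
      by simp
  qed (use meas in \<open>auto intro: measurable_sets\<close>)
  \<comment> \<open>The preimages form a pi-system, so independence on them extends to the generated
    sigma-algebras.\<close>
  moreover have "Int_stable (?G Z)" for Z
    unfolding Int_stable_def
  proof (intro ballI)
    fix a b assume "a \<in> ?G Z" "b \<in> ?G Z"
    then obtain A B where "A \<in> sets borel" "B \<in> sets borel" "a = Z -` A \<inter> space M" "b = Z -` B \<inter> space M"
      by auto
    then show "a \<inter> b \<in> ?G Z"
      by (intro CollectI exI[of _ "A \<inter> B"]) auto
  qed
  ultimately show ?thesis
    using meas by (auto simp: indep_var_eq intro: indep_set_sigma_sets)
qed

text \<open>The identity of \<open>drawdown_law\<close> holds at every fixed time, so it survives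
  mixing with the same geometric weights.\<close>

lemma (in prob_space) stopped_drawdown_law:
  assumes iid: "iid_steps M Y" and T: "geometric_time M Y q T"
  shows "distr M borel (\<lambda>\<omega>. walk Y (T \<omega>) \<omega> - walk_max Y (T \<omega>) \<omega>) =
    distr M borel (\<lambda>\<omega>. walk_min Y (T \<omega>) \<omega>)"
proof (rule measure_eqI)
  fix F :: "real set" assume "F \<in> sets (distr M borel (\<lambda>\<omega>. walk Y (T \<omega>) \<omega> - walk_max Y (T \<omega>) \<omega>))"
  then have F: "F \<in> sets borel"
    by simp
  have D: "(\<lambda>\<omega>. walk Y (T \<omega>) \<omega> - walk_max Y (T \<omega>) \<omega>) \<in> borel_measurable M"
    by (intro borel_measurable_diff stopped_walk_measurable[OF iid T])
  have "Measurable.pred (Pi\<^sub>M UNIV (\<lambda>_. borel)) (\<lambda>p. p n - Max (p ` {0..n}) \<in> F)"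
    "Measurable.pred (Pi\<^sub>M UNIV (\<lambda>_. borel)) (\<lambda>p. Min (p ` {0..n}) \<in> F)" for n :: nat
    by (intro pred_sets2[OF F] borel_measurable_Max borel_measurable_Min borel_measurable_diff
        measurable_component_singleton; simp)+
  from geometric_time_prob[OF iid T this(1)] geometric_time_prob[OF iid T this(2)]
  have "\<P>(\<omega> in M. walk Y (T \<omega>) \<omega> - walk_max Y (T \<omega>) \<omega> \<in> F) =
      \<P>(\<omega> in M. walk_min Y (T \<omega>) \<omega> \<in> F)"
    unfolding walk_max_def[symmetric] walk_min_def[symmetric] drawdown_law[OF iid F]
    by (rule sums_unique2)
  then show "emeasure (distr M borel (\<lambda>\<omega>. walk Y (T \<omega>) \<omega> - walk_max Y (T \<omega>) \<omega>)) F =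
      emeasure (distr M borel (\<lambda>\<omega>. walk_min Y (T \<omega>) \<omega>)) F"
    using F by (simp add: emeasure_distr D stopped_walk_measurable[OF iid T] emeasure_eq_measure
        vimage_def Int_def conj_commute)
qed simp

text \<open>The joint law of maximum and drawdown is the product of the laws of
  \<open>walk_max\<close> and \<open>walk_min\<close> at \<open>T\<close>. The separate variable
  \<eta> in the inner integral plays the role of an independent copy.\<close>

lemma (in prob_space) wiener_hopf_expectation:
  fixes \<phi> :: "real \<times> real \<Rightarrow> real"
  assumes iid: "iid_steps M Y" and T: "geometric_time M Y q T" and q: "0 < q" "q < 1"
    and \<phi>: "\<phi> \<in> borel_measurable borel" "\<And>p. \<bar>\<phi> p\<bar> \<le> B"
  shows "(\<integral>\<omega>. \<phi> (walk_max Y (T \<omega>) \<omega>, walk Y (T \<omega>) \<omega> - walk_max Y (T \<omega>) \<omega>) \<partial>M) =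
    (\<integral>\<omega>. (\<integral>\<eta>. \<phi> (walk_max Y (T \<omega>) \<omega>, walk_min Y (T \<eta>) \<eta>) \<partial>M) \<partial>M)"
proof -
  let ?X = "\<lambda>\<omega>. walk_max Y (T \<omega>) \<omega>" and ?D = "\<lambda>\<omega>. walk Y (T \<omega>) \<omega> - walk_max Y (T \<omega>) \<omega>"
    and ?N = "\<lambda>\<omega>. walk_min Y (T \<omega>) \<omega>"
  have X: "?X \<in> borel_measurable M" and N: "?N \<in> borel_measurable M"
    by (rule stopped_walk_measurable[OF iid T])+
  have indep: "indep_var borel ?X borel ?D"
    by (rule wiener_hopf_indep[OF iid T q])
  then have D: "?D \<in> borel_measurable M"
    by (rule indep_var_rv2)
  have \<phi>'[measurable]: "\<phi> \<in> borel_measurable (borel \<Otimes>\<^sub>M borel)"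
    using \<phi>(1) by (simp add: borel_prod)
  interpret PX: prob_space "distr M borel ?X"
    by (rule prob_space_distr[OF X])
  interpret PN: prob_space "distr M borel ?N"
    by (rule prob_space_distr[OF N])
  interpret P: pair_prob_space "distr M borel ?X" "distr M borel ?N" ..
  have "(\<integral>\<omega>. \<phi> (?X \<omega>, ?D \<omega>) \<partial>M) = (\<integral>z. \<phi> z \<partial>distr M (borel \<Otimes>\<^sub>M borel) (\<lambda>\<omega>. (?X \<omega>, ?D \<omega>)))"
    using X D by (subst integral_distr) auto
  also have "distr M (borel \<Otimes>\<^sub>M borel) (\<lambda>\<omega>. (?X \<omega>, ?D \<omega>)) = distr M borel ?X \<Otimes>\<^sub>M distr M borel ?N"
    using indep unfolding indep_var_distribution_eq stopped_drawdown_law[OF iid T] by simp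
  also have "(\<integral>z. \<phi> z \<partial>(distr M borel ?X \<Otimes>\<^sub>M distr M borel ?N)) =
      (\<integral>x. (\<integral>y. \<phi> (x, y) \<partial>distr M borel ?N) \<partial>distr M borel ?X)"
    using \<phi>(2) by (intro P.integral_fst'[symmetric] P.integrable_const_bound[of _ B])
      (auto intro!: AE_I2)
  also have "\<dots> = (\<integral>\<omega>. (\<integral>y. \<phi> (?X \<omega>, y) \<partial>distr M borel ?N) \<partial>M)"
    by (intro integral_distr X) measurable
  also have "\<dots> = (\<integral>\<omega>. (\<integral>\<eta>. \<phi> (?X \<omega>, ?N \<eta>) \<partial>M) \<partial>M)"
    by (intro Bochner_Integration.integral_cong refl integral_distr N) measurable
  finally show ?thesis .
qed

section \<open>The formula for the resolvent\<close>

text \<open>\<open>U_plus\<close> is closed, hence Borel, so extension by zero preserves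
  measurability.\<close>

lemma ext_zero_measurable:
  assumes "f \<in> borel_measurable (restrict_space borel U_plus)"
  shows "ext_zero f \<in> borel_measurable borel"
proof -
  have "U_plus = {p. 0 \<le> snd p} \<inter> {p. fst p \<le> snd p}"
    by (auto simp: U_plus_def)
  also have "closed \<dots>"
    by (intro closed_Int closed_Collect_le continuous_intros)
  finally have "U_plus \<in> sets borel"
    by (rule borel_closed)
  with assms show ?thesis
    unfolding ext_zero_def[abs_def] by (subst (asm) measurable_restrict_space_iff[where c=0]) auto
qed

lemma ext_zero_bounded:
  assumes "bounded (f ` U_plus)"
  shows "\<exists>B. \<forall>p. \<bar>ext_zero f p\<bar> \<le> B"
proof -
  from assms obtain B where "0 < B" "\<forall>x\<in>f ` U_plus. norm x \<le> B"
    by (auto simp: bounded_pos)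
  then have "\<bar>ext_zero f p\<bar> \<le> B" for p
    by (auto simp: ext_zero_def)
  then show ?thesis
    by blast
qed

text \<open>The weights \<open>(1 - q) * q ^ n\<close> are the point masses of \<open>T\<close>, so
  the normalized series is one expectation at the random time \<open>T\<close>.\<close>

lemma (in prob_space) V_tilde_resolvent:
  assumes iid: "iid_steps M Y" and T: "geometric_time M Y q T" and q: "0 < q" "q < 1"
    and f: "ext_zero f \<in> borel_measurable borel" and bound: "\<And>p. \<bar>ext_zero f p\<bar> \<le> B"
  shows "(1 - q) * V_tilde M Y f q x1 x2 =
    (\<integral>\<omega>. ext_zero f (x1 + walk Y (T \<omega>) \<omega>, max x2 (x1 + walk_max Y (T \<omega>) \<omega>)) \<partial>M)"
    (is "_ = ?I")
proof -
  have [measurable]: "ext_zero f \<in> borel_measurable (borel \<Otimes>\<^sub>M borel)"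
    using f by (simp add: borel_prod)
  have "(\<lambda>n. (1 - q) * q ^ n * V M Y f n x1 x2) sums ?I"
    unfolding V_def walk_max_def
  proof (rule geometric_time_expectation[OF iid T])
    fix n :: nat
    have [measurable]: "(\<lambda>p. Max (p ` {0..n})) \<in> borel_measurable (Pi\<^sub>M UNIV (\<lambda>_. borel :: real measure))"
      by (intro borel_measurable_Max measurable_component_singleton) auto
    show "(\<lambda>p. ext_zero f (x1 + p n, max x2 (x1 + Max (p ` {0..n})))) \<in>
        borel_measurable (Pi\<^sub>M UNIV (\<lambda>_. borel))"
      by measurable
  qed (rule bound)
  then have "(\<lambda>n. q ^ n * V M Y f n x1 x2) sums (?I / (1 - q))"
    using q by (intro sums_mult_D) (simp_all add: mult.assoc)
  then show ?thesis
    using q by (simp add: V_tilde_def sums_iff)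
qed

lemma (in prob_space) V_tilde_factorization:
  assumes iid: "iid_steps M Y" and T: "geometric_time M Y q T" and q: "0 < q" "q < 1"
    and f: "ext_zero f \<in> borel_measurable borel" and bound: "\<And>p. \<bar>ext_zero f p\<bar> \<le> B"
  shows "(1 - q) * V_tilde M Y f q x1 x2 =
    tensor_I (epv M Y T) (ext_zero f) (x1, x2) + epv_sup M Y T (\<lambda>y. w M Y T f y x2) x1"
proof -
  let ?g = "ext_zero f"
  let ?S = "\<lambda>\<omega>. walk Y (T \<omega>) \<omega>" and ?X = "\<lambda>\<omega>. walk_max Y (T \<omega>) \<omega>" and ?N = "\<lambda>\<omega>. walk_min Y (T \<omega>) \<omega>"
  note [measurable] = stopped_walk_measurable[OF iid T]
  have [measurable]: "?g \<in> borel_measurable (borel \<Otimes>\<^sub>M borel)"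
    using f by (simp add: borel_prod)
  have int: "integrable M (\<lambda>\<omega>. ?g (Z \<omega>))" if "(\<lambda>\<omega>. ?g (Z \<omega>)) \<in> borel_measurable M" for Z
    using bound that by (intro integrable_const_bound[of _ B]) auto
  \<comment> \<open>The change in payoff when the second argument is raised from \<open>x2\<close>
    to a new maximum \<open>x1 + m\<close>. Here \<open>d\<close> is the drawdown, so
    \<open>x1 + m + d\<close> is the final position.\<close>
  define \<phi> where "\<phi> = (\<lambda>(m, d). indicat_real {x2..} (x1 + m) *
    (?g (x1 + m + d, x1 + m) - ?g (x1 + m + d, x2)))"
  have \<phi>_meas: "\<phi> \<in> borel_measurable borel"
    unfolding \<phi>_def borel_prod[symmetric] by measurable
  have \<phi>_bound: "\<bar>\<phi> p\<bar> \<le> 2 * B" for p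
  proof -
    obtain m d where p: "p = (m, d)"
      by (cases p)
    show ?thesis
      using bound[of "(x1 + m + d, x1 + m)"] bound[of "(x1 + m + d, x2)"]
      unfolding p \<phi>_def by (simp add: indicator_def) linarith
  qed
  \<comment> \<open>With the maximum frozen at \<open>m\<close>, averaging over the drawdown is
    \<open>epv_inf\<close> started from \<open>y = x1 + m\<close>; this is where the diagonal
    argument \<open>(y, y)\<close> in \<open>w\<close> comes from.\<close>
  have \<phi>_inner: "(\<integral>\<eta>. \<phi> (m, ?N \<eta>) \<partial>M) = w M Y T f (x1 + m) x2" for m
    unfolding \<phi>_def w_def tensor_I_def epv_inf_def prod.case
    by (subst integral_mult_right_zero, subst Bochner_Integration.integral_diff) (auto intro!: int)
  have int_\<phi>: "integrable M (\<lambda>\<omega>. \<phi> (?X \<omega>, ?S \<omega> - ?X \<omega>))"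
  proof (rule integrable_const_bound[of _ "2 * B"])
    have [measurable]: "\<phi> \<in> borel_measurable (borel \<Otimes>\<^sub>M borel)"
      using \<phi>_meas by (simp add: borel_prod)
    show "(\<lambda>\<omega>. \<phi> (?X \<omega>, ?S \<omega> - ?X \<omega>)) \<in> borel_measurable M"
      by measurable
  qed (use \<phi>_bound in auto)
  \<comment> \<open>Below \<open>x2\<close> the indicator removes the correction; at equality the
    two terms in \<phi> cancel.\<close>
  have "?g (x1 + ?S \<omega>, max x2 (x1 + ?X \<omega>)) =
      ?g (x1 + ?S \<omega>, x2) + \<phi> (?X \<omega>, ?S \<omega> - ?X \<omega>)" for \<omega>
    by (simp add: \<phi>_def indicator_def max_def)
  then have "(1 - q) * V_tilde M Y f q x1 x2 =
      (\<integral>\<omega>. ?g (x1 + ?S \<omega>, x2) + \<phi> (?X \<omega>, ?S \<omega> - ?X \<omega>) \<partial>M)"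
    by (simp add: V_tilde_resolvent[OF iid T q f bound])
  also have "\<dots> = (\<integral>\<omega>. ?g (x1 + ?S \<omega>, x2) \<partial>M) + (\<integral>\<omega>. \<phi> (?X \<omega>, ?S \<omega> - ?X \<omega>) \<partial>M)"
    by (intro Bochner_Integration.integral_add int int_\<phi>) measurable
  also have "(\<integral>\<omega>. \<phi> (?X \<omega>, ?S \<omega> - ?X \<omega>) \<partial>M) = (\<integral>\<omega>. w M Y T f (x1 + ?X \<omega>) x2 \<partial>M)"
    unfolding wiener_hopf_expectation[OF iid T q \<phi>_meas \<phi>_bound] \<phi>_inner ..
  finally show ?thesis
    by (simp add: tensor_I_def epv_def epv_sup_def)
qed

section \<open>Analytic continuation and conclusion\<close>

text \<open>Comparison with a geometric series shows convergence on the whole open unit disc, so the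
  same power series at complex arguments is the continuation.\<close>

lemma power_series_bounded_coefficients_analytic:
  fixes a :: "nat \<Rightarrow> real"
  assumes bound: "\<And>n. \<bar>a n\<bar> \<le> B"
  obtains F :: "complex \<Rightarrow> complex" where "F analytic_on ball 0 1"
    "\<And>r. r \<in> {0<..<1} \<Longrightarrow> F (complex_of_real r) = complex_of_real (\<Sum>n. r ^ n * a n)"
proof
  let ?F = "\<lambda>z. \<Sum>n. complex_of_real (a n) * z ^ n"
  \<comment> \<open>Stated for a general field: the complex case gives analyticity, the real case
    identifies the values on the interval.\<close>
  have summable: "summable (\<lambda>n. of_real (a n) * z ^ n)"
    if "norm z < 1" for z :: "'b::{banach,real_normed_field}"
  proof (rule summable_comparison_test')
    show "summable (\<lambda>n. B * norm z ^ n)"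
      using that by (intro summable_mult summable_geometric) simp
    show "norm (of_real (a n) * z ^ n) \<le> B * norm z ^ n" for n
      using bound[of n] by (simp add: norm_mult norm_power mult_right_mono)
  qed
  show "?F analytic_on ball 0 1"
    by (rule power_series_analytic) (auto intro!: summable_sums summable)
  show "?F (complex_of_real r) = complex_of_real (\<Sum>n. r ^ n * a n)" if "r \<in> {0<..<1}" for r
    using suminf_of_real[OF summable[of r], where 'a=complex] that by (simp add: mult.commute)
qed

theorem theorem3p4:
  fixes M :: "'a measure" and Y :: "nat \<Rightarrow> 'a \<Rightarrow> real" and T :: "'a \<Rightarrow> nat"
    and q :: real and f :: "real \<times> real \<Rightarrow> real"
  assumes "prob_space M"
    and "iid_steps M Y"
    and "0 < q" and "q < 1"
    and "geometric_time M Y q T"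
    and "f \<in> borel_measurable (restrict_space borel U_plus)"
    and "bounded (f ` U_plus)"
    and "(\<lambda>y. tensor_I (epv_inf M Y T) (ext_zero f) (y, y)) \<in> borel_measurable borel"
  shows "(\<forall>x1 x2. x1 \<le> x2 \<longrightarrow>
            (1 - q) * V_tilde M Y f q x1 x2 =
              tensor_I (epv M Y T) (ext_zero f) (x1, x2)
              + epv_sup M Y T (\<lambda>y. w M Y T f y x2) x1)
       \<and> (\<forall>x1 x2. x1 \<le> x2 \<longrightarrow>
            (\<exists>F :: complex \<Rightarrow> complex. F analytic_on ball 0 1 \<and>
              (\<forall>r\<in>{0<..<1}. F (complex_of_real r) = complex_of_real (V_tilde M Y f r x1 x2))))"
proof -
  interpret prob_space M
    by fact
  note iid = \<open>iid_steps M Y\<close>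
  have f: "ext_zero f \<in> borel_measurable borel"
    by (rule ext_zero_measurable) fact
  obtain B where bound: "\<And>p. \<bar>ext_zero f p\<bar> \<le> B"
    using ext_zero_bounded[OF \<open>bounded (f ` U_plus)\<close>] by blast
  \<comment> \<open>A bound uniform in \<open>n\<close>: the numbers \<open>V M Y f n x1 x2\<close>
    are the coefficients of the power series in (ii).\<close>
  have V_bound: "\<bar>V M Y f n x1 x2\<bar> \<le> B" for n x1 x2
  proof -
    let ?h = "\<lambda>\<omega>. ext_zero f (x1 + walk Y n \<omega>, max x2 (x1 + walk_max Y n \<omega>))"
    note [measurable] = walk_measurable[OF iid] walk_max_measurable[OF iid]
    have [measurable]: "ext_zero f \<in> borel_measurable (borel \<Otimes>\<^sub>M borel)"
      using f by (simp add: borel_prod)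
    have "integrable M ?h"
      using bound by (intro integrable_const_bound[of _ B]) auto
    moreover have "?h \<omega> \<le> B" "- B \<le> ?h \<omega>" for \<omega>
      using bound[of "(x1 + walk Y n \<omega>, max x2 (x1 + walk_max Y n \<omega>))"] by linarith+
    ultimately have "expectation ?h \<le> B" "- B \<le> expectation ?h"
      by (intro integral_le_const integral_ge_const AE_I2; simp)+
    then show ?thesis
      by (simp add: V_def abs_le_iff)
  qed
  show ?thesis
  proof (intro conjI allI impI)
    fix x1 x2
    show "(1 - q) * V_tilde M Y f q x1 x2 =
        tensor_I (epv M Y T) (ext_zero f) (x1, x2) + epv_sup M Y T (\<lambda>y. w M Y T f y x2) x1"
      by (rule V_tilde_factorization[OF iid _ _ _ f bound]) fact+
    show "\<exists>F :: complex \<Rightarrow> complex. F analytic_on ball 0 1 \<and>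
        (\<forall>r\<in>{0<..<1}. F (complex_of_real r) = complex_of_real (V_tilde M Y f r x1 x2))"
      unfolding V_tilde_def
      using power_series_bounded_coefficients_analytic[of "\<lambda>n. V M Y f n x1 x2" B, OF V_bound] by metis
  qed
qed

end
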